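(* Consider the eigenvalue problem $$-\left(\varphi_p(u')\right)'+q(x)\varphi_p(u)=\lambda m(x)\varphi_p(u),\quad 0<x<T,\qquad u(0)=u(T),\ u'(0)=u'(T),$$ with the eigenvalues $\lambda_0^+>0$ and $\lambda_0^-<0$ given by the variational formulas in the context. Then $\lambda_0^+$ and $\lambda_0^-$ are isolated, that is, there exist $\delta^+>\lambda_0^+$ and $\delta^-<\lambda_0^-$ such that in the interval $(\delta^-,\delta^+)$ there is no eigenvalue of the problem other than $\lambda_0^+$ and $\lambda_0^-$.
   Context: Here $T>0$, $1<p<+\infty$, $\varphi_p(s)=|s|^{p-2}s$ (with $\varphi_p(0)=0$), $q\in C([0,T];[0,+\infty))$ with $q\not\equiv0$, and $m:[0,T]\to\mathbb{R}$ is a continuous sign-changing weight (it takes both positive and negative values). $W_T^{1,p}(0,T)=\{u\in W^{1,p}(0,T)\mid u(0)=u(T)\}$. A real number $\lambda$ is an eigenvalue if the problem has a nontrivial solution. The numbers $\lambda_0^\pm$ are $\lambda_0^+=\inf\{\int_0^T(|u'|^p+q|u|^p)\,dx\mid u\in W_T^{1,p}(0,T),\ \int_0^T m|u|^p\,dx=1\}>0$ and $\lambda_0^-=\max\{-\int_0^T(|u'|^p+q|u|^p)\,dx\mid u\in W_T^{1,p}(0,T),\ \int_0^T -m|u|^p\,dx=1\}<0$; both are eigenvalues. *)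

theory Defs
  imports "HOL-Analysis.Analysis"
begin

definition phi_p :: "real \<Rightarrow> real \<Rightarrow> real" where
  "phi_p p s = \<bar>s\<bar> powr (p - 2) * s"

(* Classical solutions: u is C^1 on [0,T] (one-sided derivatives at the end points),
   phi_p(u') is differentiable in (0,T) and the equation holds at every point. *)
definition periodic_solution ::
  "real \<Rightarrow> real \<Rightarrow> (real \<Rightarrow> real) \<Rightarrow> (real \<Rightarrow> real) \<Rightarrow> real \<Rightarrow> (real \<Rightarrow> real) \<Rightarrow> bool" where
  "periodic_solution p T q m l u \<longleftrightarrow>
     (\<exists>u'. (\<forall>x\<in>{0..T}. (u has_real_derivative u' x) (at x within {0..T})) \<and>
           continuous_on {0..T} u' \<and>
           (\<forall>x\<in>{0<..<T}. \<exists>D. ((\<lambda>y. phi_p p (u' y)) has_real_derivative D) (at x) \<and>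
               - D + q x * phi_p p (u x) = l * m x * phi_p p (u x)) \<and>
           u 0 = u T \<and> u' 0 = u' T)"

definition eigenvalue ::
  "real \<Rightarrow> real \<Rightarrow> (real \<Rightarrow> real) \<Rightarrow> (real \<Rightarrow> real) \<Rightarrow> real \<Rightarrow> bool" where
  "eigenvalue p T q m l \<longleftrightarrow>
     (\<exists>u. periodic_solution p T q m l u \<and> (\<exists>x\<in>{0..T}. u x \<noteq> 0))"

(* C_c^\<infinity>(0,T), each element extended by zero to the whole line. The closed support is
   bounded, hence compact. *)
definition test_function :: "real \<Rightarrow> (real \<Rightarrow> real) \<Rightarrow> bool" where
  "test_function T \<psi> \<longleftrightarrow>
     (\<forall>n x. ((deriv ^^ n) \<psi>) differentiable (at x)) \<and>
     closure {x. \<psi> x \<noteq> 0} \<subseteq> {0<..<T}"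

definition Lp_fun :: "real \<Rightarrow> real \<Rightarrow> (real \<Rightarrow> real) \<Rightarrow> bool" where
  "Lp_fun p T f \<longleftrightarrow>
     set_borel_measurable lborel {0<..<T} f \<and>
     set_integrable lborel {0<..<T} (\<lambda>x. \<bar>f x\<bar> powr p)"

definition weak_derivative :: "real \<Rightarrow> (real \<Rightarrow> real) \<Rightarrow> (real \<Rightarrow> real) \<Rightarrow> bool" where
  "weak_derivative T u g \<longleftrightarrow>
     (\<forall>\<psi>. test_function T \<psi> \<longrightarrow>
        (LINT x:{0<..<T}|lborel. u x * deriv \<psi> x) = - (LINT x:{0<..<T}|lborel. g x * \<psi> x))"

(* u belongs to W^{1,p}(0,T) and g is (a representative of) its weak derivative, which is
   unique up to null sets. *)
definition W1p :: "real \<Rightarrow> real \<Rightarrow> (real \<Rightarrow> real) \<Rightarrow> (real \<Rightarrow> real) \<Rightarrow> bool" where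
  "W1p p T u g \<longleftrightarrow> Lp_fun p T u \<and> Lp_fun p T g \<and> weak_derivative T u g"

(* The boundary values in u(0) = u(T) are those of the representative of the class of u
   that is continuous on [0,T]; u is taken to be that representative. *)
definition W1p_per :: "real \<Rightarrow> real \<Rightarrow> (real \<Rightarrow> real) \<Rightarrow> (real \<Rightarrow> real) \<Rightarrow> bool" where
  "W1p_per p T u g \<longleftrightarrow> W1p p T u g \<and> continuous_on {0..T} u \<and> u 0 = u T"

definition energy ::
  "real \<Rightarrow> real \<Rightarrow> (real \<Rightarrow> real) \<Rightarrow> (real \<Rightarrow> real) \<Rightarrow> (real \<Rightarrow> real) \<Rightarrow> real" where
  "energy p T q u g = (LINT x:{0<..<T}|lborel. \<bar>g x\<bar> powr p + q x * \<bar>u x\<bar> powr p)"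

definition lambda0_pos ::
  "real \<Rightarrow> real \<Rightarrow> (real \<Rightarrow> real) \<Rightarrow> (real \<Rightarrow> real) \<Rightarrow> real" where
  "lambda0_pos p T q m =
     Inf {energy p T q u g | u g.
            W1p_per p T u g \<and> (LINT x:{0<..<T}|lborel. m x * \<bar>u x\<bar> powr p) = 1}"

(* Written as a supremum: Max is only meaningful for finite sets, and the supremum equals
   the maximum when that is attained. *)
definition lambda0_neg ::
  "real \<Rightarrow> real \<Rightarrow> (real \<Rightarrow> real) \<Rightarrow> (real \<Rightarrow> real) \<Rightarrow> real" where
  "lambda0_neg p T q m =
     Sup {- energy p T q u g | u g.
            W1p_per p T u g \<and> (LINT x:{0<..<T}|lborel. - m x * \<bar>u x\<bar> powr p) = 1}"

end

theory Submission
  imports Defs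
begin

text \<open>
  Testing the equation with \<open>u\<close> gives \<open>E(u) = \<lambda> M(u)\<close> with \<open>E(u) = \<integral> |u'|\<^sup>p + q |u|\<^sup>p > 0\<close> and
  \<open>M(u) = \<integral> m |u|\<^sup>p\<close>, so a positive eigenvalue is at least \<open>\<lambda>\<^sub>0\<^sup>+\<close>, and \<open>0\<close> is not an eigenvalue.

  Let \<open>u\<close> be an eigenfunction of \<open>\<lambda> < \<lambda>\<^sub>0\<^sup>+ + \<delta>\<close> with \<open>|u(0)|\<^sup>p + |u'(0)|\<^sup>p = 1\<close>. A Gronwall
  estimate bounds \<open>|u|\<^sup>p + |u'|\<^sup>p\<close> above and below, so \<open>u\<close> crosses every zero with a definite
  slope. If there is a zero, replace \<open>u\<close> by \<open>v = (|u|\<^sup>p + \<epsilon>\<^sup>p)\<^bsup>1/p\<^esup>\<close>: this costs only \<open>O(\<epsilon>\<^sup>p)\<close> in the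
  terms of order zero, but it saves at least \<open>c \<epsilon>\<close> in the gradient term near the zero. Since \<open>p > 1\<close>,
  this contradicts \<open>\<lambda>\<^sub>0\<^sup>+ M(v) \<le> E(v)\<close> for suitable \<open>\<epsilon>\<close> and small \<open>\<delta>\<close>. So eigenfunctions of
  eigenvalues in \<open>(0, \<lambda>\<^sub>0\<^sup>+ + \<delta>)\<close> have no zeros, and by Picone's inequality at most one positive
  eigenvalue has an eigenfunction without zeros. Hence there is at most one eigenvalue in that interval,
  and no compactness argument is needed. The case of \<open>\<lambda>\<^sub>0\<^sup>-\<close> follows by replacing \<open>m\<close> with \<open>-m\<close>.
\<close>

subsection \<open>The function \<open>\<phi>\<^sub>p\<close>\<close>

lemma phi_p_zero [simp]: "phi_p p 0 = 0"
  by (simp add: phi_p_def)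

lemma phi_p_mult: "phi_p p (a * s) = phi_p p a * phi_p p s"
  by (simp add: phi_p_def abs_mult powr_mult)

lemma phi_p_times_self: "phi_p p s * s = \<bar>s\<bar> powr p"
proof (cases "s = 0")
  case False
  have "\<bar>s\<bar> powr p = \<bar>s\<bar> powr (p - 2) * \<bar>s\<bar> powr 2"
    using powr_add[of "\<bar>s\<bar>" "p - 2" 2] by simp
  then show ?thesis
    using False by (simp add: phi_p_def power2_eq_square)
qed simp

lemma abs_phi_p: "\<bar>phi_p p s\<bar> = \<bar>s\<bar> powr (p - 1)"
proof (cases "s = 0")
  case False
  have "\<bar>s\<bar> powr (p - 1) = \<bar>s\<bar> powr (p - 2) * \<bar>s\<bar> powr 1"
    using powr_add[of "\<bar>s\<bar>" "p - 2" 1] by simp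
  then show ?thesis
    using False by (simp add: phi_p_def abs_mult)
qed simp

lemma phi_p_eq_0_iff [simp]: "phi_p p s = 0 \<longleftrightarrow> s = 0"
  by (simp add: phi_p_def)

lemma abs_phi_p_powr_conjugate:
  assumes "p > 1"
  shows "\<bar>phi_p p s\<bar> powr (p / (p - 1)) = \<bar>s\<bar> powr p"
  using assms by (simp add: abs_phi_p powr_powr)

text \<open>The powers of \<open>\<bar>s\<bar>\<close> cancel because
  \<open>(p - 1) * (p / (p - 1) - 2) = 2 - p\<close>. This recovers \<open>u'\<close> from the flux
  \<open>phi_p p (u' x)\<close>, the quantity that the equation differentiates.\<close>

lemma phi_p_conjugate:
  assumes "p > 1"
  shows "phi_p (p / (p - 1)) (phi_p p s) = s"
proof (cases "s = 0")
  case False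
  have e: "(p - 1) * (p / (p - 1) - 2) = 2 - p"
    using assms by (simp add: field_simps)
  have "phi_p (p / (p - 1)) (phi_p p s) = \<bar>s\<bar> powr (2 - p) * (\<bar>s\<bar> powr (p - 2) * s)"
    by (simp add: phi_p_def[of "p / (p - 1)"] abs_phi_p powr_powr e) (simp add: phi_p_def)
  also have "\<dots> = s"
    using False by (simp flip: powr_add mult.assoc)
  finally show ?thesis .
qed simp

lemma phi_p_inverse: "phi_p p (inverse s) = inverse (phi_p p s)"
proof (cases "s = 0")
  case False
  have "phi_p p (inverse s) * phi_p p s = 1"
    using False phi_p_mult[of p "inverse s" s] by (simp add: phi_p_def)
  then show ?thesis
    by (metis inverse_unique mult.commute)
qed simp

text \<open>For p < 2 the factor \<open>\<bar>s\<bar> powr (p - 2)\<close> blows up at 0, so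
  continuity there is read off from \<open>\<bar>s\<bar> powr (p - 1)\<close>, whose exponent is
  positive.\<close>

lemma continuous_phi_p:
  assumes "p > 1"
  shows "isCont (phi_p p) s"
proof (cases "s = 0")
  case True
  have "((\<lambda>x. \<bar>x\<bar> powr (p - 1)) \<longlongrightarrow> \<bar>0\<bar> powr (p - 1)) (at (0::real))"
    using assms by (intro tendsto_powr' tendsto_rabs tendsto_ident_at tendsto_const) simp_all
  then have "(phi_p p \<longlongrightarrow> 0) (at 0)"
    by (simp flip: abs_phi_p add: tendsto_rabs_zero_iff)
  then show ?thesis
    using True by (simp add: isCont_def)
next
  case False
  then show ?thesis
    unfolding phi_p_def by (auto intro!: continuous_intros)
qed

lemma continuous_on_phi_p:
  assumes "p > 1" "continuous_on S f"
  shows "continuous_on S (\<lambda>x. phi_p p (f x))"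
  using continuous_on_compose2[of UNIV "phi_p p" S f] assms continuous_phi_p
  by (auto simp: continuous_on_eq_continuous_at)

lemma continuous_on_abs_powr:
  fixes f :: "'a::topological_space \<Rightarrow> real"
  assumes "p > 1" "continuous_on S f"
  shows "continuous_on S (\<lambda>x. \<bar>f x\<bar> powr p)"
  unfolding phi_p_times_self[symmetric]
  by (intro continuous_on_mult continuous_on_phi_p assms)

section \<open>Derivatives of powers of the absolute value\<close>

lemma has_real_derivative_abs:
  assumes "(s::real) \<noteq> 0"
  shows "(abs has_real_derivative sgn s) (at s)"
proof (rule has_field_derivative_transform_within_open)
  show "((\<lambda>x. sgn s * x) has_real_derivative sgn s) (at s)"
    by (auto intro!: derivative_eq_intros)
  show "open {x. sgn s * x > 0}"
    by (intro open_Collect_less continuous_intros)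
qed (use assms in \<open>auto simp: sgn_if abs_if split: if_splits\<close>)

lemma DERIV_abs_powr_nonzero:
  assumes "(s::real) \<noteq> 0"
  shows "((\<lambda>x. \<bar>x\<bar> powr r) has_real_derivative r * (\<bar>s\<bar> powr (r - 1) * sgn s)) (at s)"
  using DERIV_chain2[OF has_real_derivative_powr has_real_derivative_abs[OF assms], of r] assms
  by (simp add: mult.assoc)

text \<open>At 0 the difference quotient is \<open>phi_p p x\<close> itself, which tends to 0;
  elsewhere the chain rule applies.\<close>

lemma has_real_derivative_abs_powr:
  assumes "p > 1"
  shows "((\<lambda>x. \<bar>x\<bar> powr p) has_real_derivative p * phi_p p s) (at s)"
proof (cases "s = 0")
  case True
  have "((\<lambda>x. \<bar>x\<bar> powr p / x) \<longlongrightarrow> 0) (at 0)"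
  proof (rule Lim_transform_eventually)
    show "(phi_p p \<longlongrightarrow> 0) (at 0)"
      using continuous_phi_p[OF assms, of 0] by (simp add: isCont_def)
    show "\<forall>\<^sub>F x in at 0. phi_p p x = \<bar>x\<bar> powr p / x"
      by (auto simp flip: phi_p_times_self simp: eventually_at_filter)
  qed
  then show ?thesis
    using True by (simp add: has_field_derivative_iff)
next
  case False
  have "\<bar>s\<bar> powr (p - 1) = \<bar>s\<bar> powr (p - 2) * \<bar>s\<bar>"
    using False powr_add[of "\<bar>s\<bar>" "p - 2" 1] by simp
  then show ?thesis
    using DERIV_abs_powr_nonzero[OF False, of p] by (simp add: phi_p_def mult.assoc abs_mult_sgn)
qed

lemma has_real_derivative_phi_p:
  assumes "s \<noteq> 0"
  shows "(phi_p p has_real_derivative (p - 1) * \<bar>s\<bar> powr (p - 2)) (at s)"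
proof -
  have "\<bar>s\<bar> powr (p - 2) = \<bar>s\<bar> powr (p - 3) * \<bar>s\<bar>"
    using assms powr_add[of "\<bar>s\<bar>" "p - 3" 1] by simp
  then have "(p - 2) * (\<bar>s\<bar> powr (p - 2 - 1) * sgn s) * s + 1 * \<bar>s\<bar> powr (p - 2)
      = (p - 1) * \<bar>s\<bar> powr (p - 2)"
    by (simp add: abs_if sgn_if algebra_simps)
  then show ?thesis
    using DERIV_mult[OF DERIV_abs_powr_nonzero[OF assms, of "p - 2"] DERIV_ident]
    by (simp add: phi_p_def[abs_def] mult.commute)
qed

text \<open>The left-hand side, as a function of \<open>a\<close>, is the tangent at
  \<open>w\<close> to the convex function \<open>\<bar>a\<bar> powr p\<close>. It follows from
  Young's inequality for \<open>\<bar>a\<bar>\<close> and \<open>\<bar>phi_p p w\<bar>\<close> with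
  conjugate exponents.\<close>

lemma young_phi_p:
  assumes "p > 1"
  shows "p * phi_p p w * a - (p - 1) * \<bar>w\<bar> powr p \<le> \<bar>a\<bar> powr p"
proof -
  have "\<bar>a\<bar> * \<bar>phi_p p w\<bar> \<le> \<bar>a\<bar> powr p / p + \<bar>phi_p p w\<bar> powr (p / (p - 1)) / (p / (p - 1))"
    using assms by (intro Youngs_inequality) (auto simp: field_simps)
  then have "\<bar>a\<bar> * \<bar>phi_p p w\<bar> \<le> \<bar>a\<bar> powr p / p + \<bar>w\<bar> powr p * (p - 1) / p"
    unfolding abs_phi_p_powr_conjugate[OF assms] by simp
  then have "p * (\<bar>a\<bar> * \<bar>phi_p p w\<bar>) \<le> \<bar>a\<bar> powr p + \<bar>w\<bar> powr p * (p - 1)"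
    using assms by (simp add: field_simps)
  moreover have "phi_p p w * a \<le> \<bar>a\<bar> * \<bar>phi_p p w\<bar>"
    by (metis abs_ge_self abs_mult mult.commute)
  then have "p * (phi_p p w * a) \<le> p * (\<bar>a\<bar> * \<bar>phi_p p w\<bar>)"
    using assms by (intro mult_left_mono) auto
  ultimately show ?thesis
    by (simp add: algebra_simps)
qed

lemma abs_times_abs_phi_p_le:
  assumes "p > 1"
  shows "\<bar>a\<bar> * \<bar>phi_p p b\<bar> \<le> \<bar>b\<bar> powr p + \<bar>a\<bar> powr p"
proof -
  define M where "M = max \<bar>a\<bar> \<bar>b\<bar>"
  have "\<bar>a\<bar> * \<bar>phi_p p b\<bar> \<le> M * M powr (p - 1)"
    unfolding abs_phi_p using assms by (intro mult_mono powr_mono2) (auto simp: M_def)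
  also have "\<dots> = M powr p"
    using abs_ge_zero[of a] by (cases "M = 0") (auto simp: M_def powr_diff)
  also have "\<dots> \<le> \<bar>b\<bar> powr p + \<bar>a\<bar> powr p"
    by (auto simp: M_def max_def)
  finally show ?thesis .
qed

text \<open>\<open>V x * exp (C * x)\<close> is nondecreasing and \<open>V x * exp (- C * x)\<close>
  is nonincreasing. Both directions matter later: one bounds a solution from above, the other keeps
  it away from 0.\<close>

lemma gronwall_two_sided:
  fixes V :: "real \<Rightarrow> real"
  assumes cont: "continuous_on {a..b} V"
    and deriv: "\<And>x. x \<in> {a<..<b} \<Longrightarrow> (V has_real_derivative V' x) (at x)"
    and bound: "\<And>x. x \<in> {a<..<b} \<Longrightarrow> \<bar>V' x\<bar> \<le> C * V x"
    and xy: "x \<in> {a..b}" "y \<in> {a..b}"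
  shows "V x \<le> V y * exp (C * \<bar>x - y\<bar>)"
proof (cases "x \<le> y")
  case True
  have "V x * exp (C * x) \<le> V y * exp (C * y)"
  proof (rule DERIV_nonneg_imp_increasing_open[OF True])
    fix z assume "x < z" "z < y"
    then have z: "z \<in> {a<..<b}" using xy by auto
    have "((\<lambda>z. V z * exp (C * z)) has_real_derivative (V' z + C * V z) * exp (C * z)) (at z)"
      using deriv[OF z] by (auto intro!: derivative_eq_intros simp: algebra_simps)
    moreover have "0 \<le> (V' z + C * V z) * exp (C * z)"
      using bound[OF z] by (intro mult_nonneg_nonneg) auto
    ultimately show "\<exists>d. ((\<lambda>z. V z * exp (C * z)) has_real_derivative d) (at z) \<and> 0 \<le> d"
      by blast
  next
    show "continuous_on {x..y} (\<lambda>z. V z * exp (C * z))"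
      using continuous_on_subset[OF cont, of "{x..y}"] xy by (auto intro!: continuous_intros)
  qed
  moreover have "exp (C * y) = exp (C * (y - x)) * exp (C * x)"
    by (simp flip: exp_add add: algebra_simps)
  ultimately have "V x * exp (C * x) \<le> V y * exp (C * (y - x)) * exp (C * x)"
    by (simp add: mult.assoc)
  then show ?thesis
    using True by simp
next
  case False
  have "- (V y * exp (- C * y)) \<le> - (V x * exp (- C * x))"
  proof (rule DERIV_nonneg_imp_increasing_open[of y x])
    fix z assume "y < z" "z < x"
    then have z: "z \<in> {a<..<b}" using xy by auto
    have "((\<lambda>z. - (V z * exp (- C * z))) has_real_derivative (C * V z - V' z) * exp (- C * z)) (at z)"
      using deriv[OF z] by (auto intro!: derivative_eq_intros simp: algebra_simps)
    moreover have "0 \<le> (C * V z - V' z) * exp (- C * z)"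
      using bound[OF z] by (intro mult_nonneg_nonneg) auto
    ultimately show "\<exists>d. ((\<lambda>z. - (V z * exp (- C * z))) has_real_derivative d) (at z) \<and> 0 \<le> d"
      by blast
  next
    show "continuous_on {y..x} (\<lambda>z. - (V z * exp (- C * z)))"
      using continuous_on_subset[OF cont, of "{y..x}"] xy by (auto intro!: continuous_intros)
  qed (use False in simp)
  moreover have "exp (- C * y) = exp (C * (x - y)) * exp (- C * x)"
    by (simp flip: exp_add add: algebra_simps)
  ultimately have "V x * exp (- C * x) \<le> V y * exp (C * (x - y)) * exp (- C * x)"
    by (simp add: mult.assoc)
  then show ?thesis
    using False by simp
qed

subsection \<open>The variational inequality for \<open>C\<^sup>1\<close> functions\<close>

text \<open>Passes from the Lebesgue integrals over the open interval in the definitions to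
  integrals over \<open>{0..T}\<close>, to which the fundamental theorem of calculus
  applies.\<close>

lemma lborel_Ioo_continuous:
  fixes f :: "real \<Rightarrow> real"
  assumes "continuous_on {0..T} f"
  shows "set_integrable lborel {0<..<T} f"
    and "(LINT x:{0<..<T}|lborel. f x) = integral {0..T} f"
proof -
  show *: "set_integrable lborel {0<..<T} f"
    using borel_integrable_atLeastAtMost'[OF assms]
    by (rule set_integrable_subset) auto
  show "(LINT x:{0<..<T}|lborel. f x) = integral {0..T} f"
    using set_borel_integral_eq_integral(2)[OF *] by (simp add: integral_open_interval_real)
qed

definition C1_on :: "real \<Rightarrow> (real \<Rightarrow> real) \<Rightarrow> (real \<Rightarrow> real) \<Rightarrow> bool" where
  "C1_on T u u' \<longleftrightarrow>
     (\<forall>x\<in>{0..T}. (u has_real_derivative u' x) (at x within {0..T})) \<and> continuous_on {0..T} u'"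

lemma C1_on_continuous:
  assumes "C1_on T u u'"
  shows "continuous_on {0..T} u" "continuous_on {0..T} u'"
  using assms DERIV_continuous_on[of "{0..T}" u u'] by (auto simp: C1_on_def)

lemma C1_on_deriv:
  assumes "C1_on T u u'" "x \<in> {0<..<T}"
  shows "(u has_real_derivative u' x) (at x)"
proof -
  have "at x within {0..T} = at x"
    using assms(2) by (intro at_within_interior) auto
  then show ?thesis
    using assms by (auto simp: C1_on_def dest!: bspec[of _ _ x])
qed

lemma C1_on_scale: "C1_on T u u' \<Longrightarrow> C1_on T (\<lambda>x. a * u x) (\<lambda>x. a * u' x)"
  by (auto simp: C1_on_def intro!: DERIV_cmult continuous_intros)

text \<open>Integration by parts; the boundary terms vanish because the support of a test function
  lies in the open interval.\<close>

lemma weak_derivative_C1_on: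
  assumes u: "C1_on T u u'" and T: "T > 0"
  shows "weak_derivative T u u'"
  unfolding weak_derivative_def
proof (intro allI impI)
  fix \<psi> assume psi: "test_function T \<psi>"
  have d: "\<psi> differentiable (at x)" "deriv \<psi> differentiable (at x)" for x
    using psi[unfolded test_function_def, THEN conjunct1, rule_format, of 0 x]
      psi[unfolded test_function_def, THEN conjunct1, rule_format, of 1 x] by simp_all
  have der: "(\<psi> has_real_derivative deriv \<psi> x) (at x)" for x
    using d(1) DERIV_deriv_iff_real_differentiable by blast
  have c: "continuous_on {0..T} \<psi>" "continuous_on {0..T} (deriv \<psi>)"
    using d by (auto intro!: continuous_at_imp_continuous_on differentiable_imp_continuous_within)
  have "{x. \<psi> x \<noteq> 0} \<subseteq> {0<..<T}"
    using psi closure_subset[of "{x. \<psi> x \<noteq> 0}"] unfolding test_function_def by (meson order_trans)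
  then have z: "\<psi> 0 = 0" "\<psi> T = 0"
    by auto
  note cu = C1_on_continuous[OF u]
  have "((\<lambda>x. u x * deriv \<psi> x + u' x * \<psi> x) has_integral (u T * \<psi> T - u 0 * \<psi> 0)) {0..T}"
  proof (rule fundamental_theorem_of_calculus_interior)
    fix x assume "x \<in> {0<..<T}"
    from DERIV_mult[OF C1_on_deriv[OF u this] der]
    show "((\<lambda>x. u x * \<psi> x) has_vector_derivative u x * deriv \<psi> x + u' x * \<psi> x) (at x)"
      by (simp add: has_real_derivative_iff_has_vector_derivative add.commute mult.commute)
  qed (use T c cu in \<open>auto intro!: continuous_intros\<close>)
  then have "integral {0..T} (\<lambda>x. u x * deriv \<psi> x + u' x * \<psi> x) = 0"
    using z by auto
  then have "integral {0..T} (\<lambda>x. u x * deriv \<psi> x) + integral {0..T} (\<lambda>x. u' x * \<psi> x) = 0"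
    by (subst (asm) integral_add) (auto intro!: integrable_continuous_real continuous_intros c cu)
  then show "(LINT x:{0<..<T}|lborel. u x * deriv \<psi> x) = - (LINT x:{0<..<T}|lborel. u' x * \<psi> x)"
    by (subst (1 2) lborel_Ioo_continuous(2)) (auto intro!: continuous_intros c cu)
qed

lemma Lp_fun_continuous:
  assumes "p > 1" "continuous_on {0..T} f"
  shows "Lp_fun p T f"
  unfolding Lp_fun_def
proof
  show "set_borel_measurable lborel {0<..<T} f"
    unfolding set_borel_measurable_def
    using borel_measurable_continuous_on_indicator[of "{0<..<T}" f]
      continuous_on_subset[OF assms(2) greaterThanLessThan_subseteq_atLeastAtMost_iff[THEN iffD2]]
    by simp
  show "set_integrable lborel {0<..<T} (\<lambda>x. \<bar>f x\<bar> powr p)"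
    by (intro lborel_Ioo_continuous continuous_on_abs_powr assms)
qed

section \<open>Energy, weighted mass and normalization\<close>

definition C1_energy :: "real \<Rightarrow> real \<Rightarrow> (real \<Rightarrow> real) \<Rightarrow> (real \<Rightarrow> real) \<Rightarrow> (real \<Rightarrow> real) \<Rightarrow> real" where
  "C1_energy p T q u u' = integral {0..T} (\<lambda>x. \<bar>u' x\<bar> powr p + q x * \<bar>u x\<bar> powr p)"

definition weighted_mass :: "real \<Rightarrow> real \<Rightarrow> (real \<Rightarrow> real) \<Rightarrow> (real \<Rightarrow> real) \<Rightarrow> real" where
  "weighted_mass p T m u = integral {0..T} (\<lambda>x. m x * \<bar>u x\<bar> powr p)"

lemma C1_energy_scale: "C1_energy p T q (\<lambda>x. a * u x) (\<lambda>x. a * u' x) = \<bar>a\<bar> powr p * C1_energy p T q u u'"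
  unfolding C1_energy_def
  by (simp add: abs_mult powr_mult algebra_simps flip: integral_mult_right)

lemma weighted_mass_scale: "weighted_mass p T m (\<lambda>x. a * u x) = \<bar>a\<bar> powr p * weighted_mass p T m u"
  unfolding weighted_mass_def
  by (simp add: abs_mult powr_mult algebra_simps flip: integral_mult_right)

text \<open>Nothing is assumed of \<open>u\<close> and \<open>u'\<close>: if the integrand is not
  integrable, the integral has the default value 0.\<close>

lemma C1_energy_nonneg:
  assumes "\<forall>x\<in>{0..T}. q x \<ge> 0"
  shows "C1_energy p T q u u' \<ge> 0"
proof (cases "(\<lambda>x. \<bar>u' x\<bar> powr p + q x * \<bar>u x\<bar> powr p) integrable_on {0..T}")
  case True
  then show ?thesis
    unfolding C1_energy_def using assms by (intro integral_nonneg) auto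
qed (simp add: C1_energy_def not_integrable_integral)

lemma energy_nonneg:
  assumes "\<forall>x\<in>{0..T}. q x \<ge> 0"
  shows "energy p T q u g \<ge> 0"
  unfolding energy_def set_lebesgue_integral_def using assms
  by (intro Bochner_Integration.integral_nonneg) (auto simp: indicator_def)

text \<open>Energy and mass are both homogeneous of degree \<open>p\<close>, so scaling by the
  \<open>-1/p\<close>-th power of the mass gives mass 1 and turns the energy into the Rayleigh
  quotient of \<open>u\<close>.\<close>

lemma normalized_C1_admissible:
  assumes T: "T > 0" and p: "p > 1" and q: "continuous_on {0..T} q" and m: "continuous_on {0..T} m"
    and u: "C1_on T u u'" and per: "u 0 = u T" and pos: "weighted_mass p T m u > 0"
  obtains v v' where "W1p_per p T v v'" "(LINT x:{0<..<T}|lborel. m x * \<bar>v x\<bar> powr p) = 1"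
    "energy p T q v v' = C1_energy p T q u u' / weighted_mass p T m u"
proof -
  define a where "a = weighted_mass p T m u powr (- 1 / p)"
  define v where "v = (\<lambda>x. a * u x)"
  define v' where "v' = (\<lambda>x. a * u' x)"
  have "\<bar>a\<bar> powr p = weighted_mass p T m u powr (- 1)"
    unfolding a_def abs_of_nonneg[OF powr_ge_zero] powr_powr using p by simp
  then have a: "\<bar>a\<bar> powr p = 1 / weighted_mass p T m u"
    using pos by (simp add: powr_minus_divide)
  have v: "C1_on T v v'"
    using C1_on_scale[OF u] by (simp add: v_def v'_def)
  note cv = C1_on_continuous[OF v]
  have "W1p_per p T v v'"
    using weak_derivative_C1_on[OF v T] cv per p
    by (auto simp: W1p_per_def W1p_def v_def intro!: Lp_fun_continuous)
  moreover have "(LINT x:{0<..<T}|lborel. m x * \<bar>v x\<bar> powr p) = weighted_mass p T m v"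
    unfolding weighted_mass_def
    by (intro lborel_Ioo_continuous continuous_intros continuous_on_abs_powr cv m p)
  moreover have "energy p T q v v' = C1_energy p T q v v'"
    unfolding C1_energy_def energy_def
    by (intro lborel_Ioo_continuous continuous_on_add continuous_on_mult continuous_on_abs_powr cv q p)
  ultimately show ?thesis
    using that[of v v'] a pos by (simp add: v_def v'_def C1_energy_scale weighted_mass_scale)
qed

lemma lambda0_pos_le:
  assumes T: "T > 0" and p: "p > 1" and q: "continuous_on {0..T} q" "\<forall>x\<in>{0..T}. q x \<ge> 0"
    and m: "continuous_on {0..T} m"
    and u: "C1_on T u u'" and per: "u 0 = u T" and pos: "weighted_mass p T m u > 0"
  shows "lambda0_pos p T q m \<le> C1_energy p T q u u' / weighted_mass p T m u"
proof -
  obtain v v' where v: "W1p_per p T v v'" "(LINT x:{0<..<T}|lborel. m x * \<bar>v x\<bar> powr p) = 1"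
    "energy p T q v v' = C1_energy p T q u u' / weighted_mass p T m u"
    using normalized_C1_admissible[OF T p q(1) m u per pos] by blast
  show ?thesis
    unfolding lambda0_pos_def v(3)[symmetric]
  proof (rule cInf_lower)
    show "bdd_below {energy p T q u g |u g. W1p_per p T u g \<and>
        (LINT x:{0<..<T}|lborel. m x * \<bar>u x\<bar> powr p) = 1}"
      using energy_nonneg[OF q(2)] by (auto intro!: bdd_belowI[of _ 0])
    show "energy p T q v v' \<in> {energy p T q u g |u g. W1p_per p T u g \<and>
        (LINT x:{0<..<T}|lborel. m x * \<bar>u x\<bar> powr p) = 1}"
      using v(1,2) by (intro CollectI exI[of _ v] exI[of _ v'] conjI refl)
  qed
qed

text \<open>The function \<open>u\<close> of positive mass serves to make the admissible set
  nonempty, so that its infimum inherits the lower bound 0.\<close>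

lemma lambda0_pos_nonneg:
  assumes T: "T > 0" and p: "p > 1" and q: "continuous_on {0..T} q" "\<forall>x\<in>{0..T}. q x \<ge> 0"
    and m: "continuous_on {0..T} m"
    and u: "C1_on T u u'" and per: "u 0 = u T" and pos: "weighted_mass p T m u > 0"
  shows "lambda0_pos p T q m \<ge> 0"
proof -
  obtain v v' where v: "W1p_per p T v v'" "(LINT x:{0<..<T}|lborel. m x * \<bar>v x\<bar> powr p) = 1"
    using normalized_C1_admissible[OF T p q(1) m u per pos] by blast
  show ?thesis
    unfolding lambda0_pos_def
    by (rule cInf_greatest) (use v energy_nonneg[OF q(2)] in auto)
qed

subsection \<open>Solutions of the equation\<close>

text \<open>The equation is solved for the derivative of the flux, and \<open>u'\<close> is a
  parameter, because the flux \<open>phi_p p (u' y)\<close> is differentiable while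
  \<open>u'\<close> itself may fail to be.\<close>

definition solution_pair ::
  "real \<Rightarrow> real \<Rightarrow> (real \<Rightarrow> real) \<Rightarrow> (real \<Rightarrow> real) \<Rightarrow> real \<Rightarrow> (real \<Rightarrow> real) \<Rightarrow> (real \<Rightarrow> real) \<Rightarrow> bool" where
  "solution_pair p T q m l u u' \<longleftrightarrow> C1_on T u u' \<and> u 0 = u T \<and> u' 0 = u' T \<and>
     (\<forall>x\<in>{0<..<T}. ((\<lambda>y. phi_p p (u' y)) has_real_derivative (q x - l * m x) * phi_p p (u x)) (at x))"

lemma periodic_solution_iff_solution_pair:
  "periodic_solution p T q m l u \<longleftrightarrow> (\<exists>u'. solution_pair p T q m l u u')"
proof -
  have "(\<exists>D. (f has_real_derivative D) (at x) \<and> - D + a * c = b * c) \<longleftrightarrow>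
      (f has_real_derivative (a - b) * c) (at x)" for f :: "real \<Rightarrow> real" and a b c x
  proof -
    have "- D + a * c = b * c \<longleftrightarrow> D = (a - b) * c" for D
      by (auto simp: algebra_simps)
    then show ?thesis by auto
  qed
  note * = this
  show ?thesis
    unfolding periodic_solution_def solution_pair_def C1_on_def *
    by (intro arg_cong[of _ _ Ex] ext) (rule iffI; elim conjE; intro conjI; assumption)
qed

lemma eigenvalue_iff_solution_pair:
  "eigenvalue p T q m l \<longleftrightarrow> (\<exists>u u'. solution_pair p T q m l u u' \<and> (\<exists>x\<in>{0..T}. u x \<noteq> 0))"
  by (auto simp: eigenvalue_def periodic_solution_iff_solution_pair)

lemma solution_pair_scale:
  assumes "solution_pair p T q m l u u'"
  shows "solution_pair p T q m l (\<lambda>x. a * u x) (\<lambda>x. a * u' x)"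
  using assms C1_on_scale[of T u u' a]
  by (auto simp: solution_pair_def phi_p_mult mult.left_commute intro!: DERIV_cmult)

text \<open>The derivative of \<open>phi_p p (u' x) * u x\<close> is the energy density minus
  \<open>l\<close> times the mass density, and the boundary terms cancel by periodicity.\<close>

lemma solution_pair_energy:
  assumes T: "T > 0" and p: "p > 1" and q: "continuous_on {0..T} q" and m: "continuous_on {0..T} m"
    and s: "solution_pair p T q m l u u'"
  shows "C1_energy p T q u u' = l * weighted_mass p T m u"
proof -
  have u: "C1_on T u u'" using s by (simp add: solution_pair_def)
  note cu = C1_on_continuous[OF u]
  have "((\<lambda>x. (\<bar>u' x\<bar> powr p + q x * \<bar>u x\<bar> powr p) - l * (m x * \<bar>u x\<bar> powr p)) has_integral
      (phi_p p (u' T) * u T - phi_p p (u' 0) * u 0)) {0..T}"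
  proof (rule fundamental_theorem_of_calculus_interior)
    fix x assume x: "x \<in> {0<..<T}"
    have "((\<lambda>x. phi_p p (u' x) * u x) has_real_derivative
        ((q x - l * m x) * phi_p p (u x)) * u x + u' x * phi_p p (u' x)) (at x)"
      using s x by (intro DERIV_mult C1_on_deriv[OF u]) (auto simp: solution_pair_def)
    moreover have "((q x - l * m x) * phi_p p (u x)) * u x + u' x * phi_p p (u' x)
        = (\<bar>u' x\<bar> powr p + q x * \<bar>u x\<bar> powr p) - l * (m x * \<bar>u x\<bar> powr p)"
      by (simp flip: phi_p_times_self add: algebra_simps)
    ultimately show "((\<lambda>x. phi_p p (u' x) * u x) has_vector_derivative
        (\<bar>u' x\<bar> powr p + q x * \<bar>u x\<bar> powr p) - l * (m x * \<bar>u x\<bar> powr p)) (at x)"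
      by (simp add: has_real_derivative_iff_has_vector_derivative)
  qed (use T p cu in \<open>auto intro!: continuous_on_mult continuous_on_phi_p\<close>)
  then have "integral {0..T} (\<lambda>x. (\<bar>u' x\<bar> powr p + q x * \<bar>u x\<bar> powr p) - l * (m x * \<bar>u x\<bar> powr p)) = 0"
    using s by (auto simp: solution_pair_def)
  then have "C1_energy p T q u u' - integral {0..T} (\<lambda>x. l * (m x * \<bar>u x\<bar> powr p)) = 0"
    unfolding C1_energy_def
    by (subst (asm) integral_diff)
      (auto intro!: integrable_continuous_real continuous_intros continuous_on_abs_powr cu p q m)
  then show ?thesis
    by (simp add: weighted_mass_def)
qed

text \<open>If the energy were 0, its continuous nonnegative density would vanish, so
  \<open>u\<close> would be constant, and equal to 0 at a point where \<open>q\<close> is not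
  0.\<close>

lemma C1_energy_pos:
  assumes T: "T > 0" and p: "p > 1"
    and q: "continuous_on {0..T} q" "\<forall>x\<in>{0..T}. q x \<ge> 0" "\<exists>x\<in>{0..T}. q x \<noteq> 0"
    and u: "C1_on T u u'" and nz: "\<exists>x\<in>{0..T}. u x \<noteq> 0"
  shows "C1_energy p T q u u' > 0"
proof (rule ccontr)
  assume "\<not> ?thesis"
  then have "C1_energy p T q u u' = 0"
    using C1_energy_nonneg[OF q(2), of p u u'] by simp
  note cu = C1_on_continuous[OF u]
  have c: "continuous_on {0..T} (\<lambda>x. \<bar>u' x\<bar> powr p + q x * \<bar>u x\<bar> powr p)"
    by (intro continuous_on_add continuous_on_mult continuous_on_abs_powr cu q p)
  have "\<bar>u' x\<bar> powr p + q x * \<bar>u x\<bar> powr p = 0" if "x \<in> {0..T}" for x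
    using integral_eq_0_iff[OF c] T q(2) \<open>C1_energy p T q u u' = 0\<close> that by (auto simp: C1_energy_def)
  then have 0: "u' x = 0" "q x * \<bar>u x\<bar> powr p = 0" if "x \<in> {0..T}" for x
    using that q(2) by (simp_all add: add_nonneg_eq_0_iff)
  obtain y where y: "y \<in> {0..T}" "q y \<noteq> 0" using q(3) by blast
  have d: "(u has_real_derivative 0) (at z)" if "0 < z" "z < T" for z
    using C1_on_deriv[OF u, of z] 0(1)[of z] that by simp
  have const: "u x = u 0" if "x \<in> {0..T}" for x
    using DERIV_isconst2[OF T cu(1) d, of x] that by auto
  have "u y = 0"
    using 0(2)[OF y(1)] y(2) by simp
  then show False
    using const nz y(1) by (metis (no_types))
qed

lemma C1_energy_minus_weighted_mass_has_integral:
  assumes p: "p > 1" and q: "continuous_on {0..T} q" and m: "continuous_on {0..T} m"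
    and u: "C1_on T u u'"
  shows "((\<lambda>x. (\<bar>u' x\<bar> powr p + q x * \<bar>u x\<bar> powr p) - l * (m x * \<bar>u x\<bar> powr p)) has_integral
    (C1_energy p T q u u' - l * weighted_mass p T m u)) {0..T}"
  unfolding C1_energy_def weighted_mass_def using C1_on_continuous[OF u]
  by (intro has_integral_diff has_integral_mult_right integrable_integral integrable_continuous_real
      continuous_intros continuous_on_abs_powr p q m)

text \<open>The factor depends only on \<open>p\<close>, \<open>T\<close> and \<open>K\<close>,
  hence is uniform for \<open>l\<close> in a bounded range. Exchanging \<open>x\<close> and
  \<open>y\<close> gives the lower bound, so a solution and its slope cannot be small
  together.\<close>

lemma solution_pair_comparison:
  assumes p: "p > 1" and s: "solution_pair p T q m l u u'"
    and K: "\<And>x. x \<in> {0..T} \<Longrightarrow> \<bar>q x - l * m x\<bar> \<le> K"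
    and xy: "x \<in> {0..T}" "y \<in> {0..T}"
  shows "\<bar>u x\<bar> powr p + \<bar>u' x\<bar> powr p
    \<le> (\<bar>u y\<bar> powr p + \<bar>u' y\<bar> powr p) * exp ((p + p / (p - 1) * K) * T)"
proof -
  \<comment> \<open>Although \<open>u'\<close> need not be differentiable, \<open>|u'|\<^sup>p = |\<phi>\<^sub>p(u')|\<^bsup>p/(p-1)\<^esup>\<close> is.\<close>
  let ?V = "\<lambda>x. \<bar>u x\<bar> powr p + \<bar>u' x\<bar> powr p"
  let ?C = "p + p / (p - 1) * K"
  have u: "C1_on T u u'" using s by (simp add: solution_pair_def)
  note cu = C1_on_continuous[OF u]
  have K0: "K \<ge> 0" using K[OF xy(1)] by linarith
  have p': "p / (p - 1) > 1" using p by simp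
  have "?V x \<le> ?V y * exp (?C * \<bar>x - y\<bar>)"
  proof (rule gronwall_two_sided[OF _ _ _ xy])
    show "continuous_on {0..T} ?V"
      by (intro continuous_intros continuous_on_abs_powr p cu)
    fix z assume z: "z \<in> {0<..<T}"
    have 1: "((\<lambda>x. \<bar>u x\<bar> powr p) has_real_derivative p * phi_p p (u z) * u' z) (at z)"
      by (rule DERIV_chain2[OF has_real_derivative_abs_powr[OF p] C1_on_deriv[OF u z]])
    have "((\<lambda>y. phi_p p (u' y)) has_real_derivative (q z - l * m z) * phi_p p (u z)) (at z)"
      using s z by (simp add: solution_pair_def)
    from DERIV_chain2[OF has_real_derivative_abs_powr[OF p'] this]
    have 2: "((\<lambda>x. \<bar>u' x\<bar> powr p) has_real_derivative
        p / (p - 1) * u' z * ((q z - l * m z) * phi_p p (u z))) (at z)"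
      by (simp add: abs_phi_p_powr_conjugate[OF p] phi_p_conjugate[OF p])
    let ?D = "p * phi_p p (u z) * u' z + p / (p - 1) * u' z * ((q z - l * m z) * phi_p p (u z))"
    show "(?V has_real_derivative ?D) (at z)"
      by (rule DERIV_add[OF 1 2])
    have "?D = (p + p / (p - 1) * (q z - l * m z)) * (u' z * phi_p p (u z))"
      by (simp add: algebra_simps)
    then have "\<bar>?D\<bar> = \<bar>p + p / (p - 1) * (q z - l * m z)\<bar> * (\<bar>u' z\<bar> * \<bar>phi_p p (u z)\<bar>)"
      by (simp add: abs_mult)
    also have "\<dots> \<le> ?C * ?V z"
    proof (rule mult_mono)
      have "\<bar>p / (p - 1) * (q z - l * m z)\<bar> \<le> p / (p - 1) * K"
        unfolding abs_mult using p z K[of z] by (intro mult_mono) auto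
      then show "\<bar>p + p / (p - 1) * (q z - l * m z)\<bar> \<le> ?C"
        using p by linarith
      show "0 \<le> ?C" using p K0 by simp
    qed (use abs_times_abs_phi_p_le[OF p] in auto)
    finally show "\<bar>?D\<bar> \<le> ?C * ?V z" .
  qed
  also have "\<dots> \<le> ?V y * exp (?C * T)"
    using xy p K0 by (intro mult_left_mono) (auto intro!: mult_left_mono)
  finally show ?thesis .
qed

subsection \<open>Smoothing the absolute value\<close>

text \<open>With \<open>e > 0\<close> the base of the root stays positive, so the root is
  continuously differentiable even at zeros of \<open>u\<close>.\<close>

lemma C1_on_smoothed_abs:
  assumes p: "p > 1" and e: "e > 0" and u: "C1_on T u u'"
  shows "C1_on T (\<lambda>x. (\<bar>u x\<bar> powr p + e powr p) powr (1 / p))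
    (\<lambda>x. (\<bar>u x\<bar> powr p + e powr p) powr (1 / p - 1) * phi_p p (u x) * u' x)"
  unfolding C1_on_def
proof (intro conjI ballI)
  have S: "\<bar>u x\<bar> powr p + e powr p > 0" for x
    using e by (intro add_nonneg_pos) auto
  fix x assume x: "x \<in> {0..T}"
  have "((\<lambda>x. \<bar>u x\<bar> powr p + e powr p) has_real_derivative p * phi_p p (u x) * u' x)
      (at x within {0..T})"
    using DERIV_add[OF DERIV_chain2[OF has_real_derivative_abs_powr[OF p]] DERIV_const] u x
    by (fastforce simp: C1_on_def)
  from DERIV_chain2[OF has_real_derivative_powr[OF S] this, of "1 / p"]
  show "((\<lambda>x. (\<bar>u x\<bar> powr p + e powr p) powr (1 / p)) has_real_derivative
      (\<bar>u x\<bar> powr p + e powr p) powr (1 / p - 1) * phi_p p (u x) * u' x) (at x within {0..T})"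
    using p by (simp add: mult.assoc)
next
  have S: "\<bar>u x\<bar> powr p + e powr p \<noteq> 0" for x
    using e by (simp add: add_nonneg_eq_0_iff)
  show "continuous_on {0..T} (\<lambda>x. (\<bar>u x\<bar> powr p + e powr p) powr (1 / p - 1) * phi_p p (u x) * u' x)"
    by (intro continuous_on_mult continuous_on_phi_p continuous_on_powr continuous_on_add
        continuous_on_abs_powr continuous_on_const p C1_on_continuous[OF u] ballI S)
qed

lemma abs_smoothed_abs_powr:
  fixes s :: real
  assumes p: "p > 1" and e: "e > 0"
  shows "\<bar>(\<bar>s\<bar> powr p + e powr p) powr (1 / p)\<bar> powr p = \<bar>s\<bar> powr p + e powr p"
  using assms by (simp add: powr_powr)

text \<open>Smoothing multiplies the gradient term by a factor that is at most 1 everywhere, and at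
  most \<open>(1 / 2) powr (p - 1)\<close> where \<open>\<bar>s\<bar> \<le> e\<close>; this is the
  source of the gain.\<close>

lemma abs_smoothed_abs_deriv_powr:
  assumes p: "p > 1" and e: "e > 0"
  shows "\<bar>(\<bar>s\<bar> powr p + e powr p) powr (1 / p - 1) * phi_p p s * a\<bar> powr p
    = (\<bar>s\<bar> powr p / (\<bar>s\<bar> powr p + e powr p)) powr (p - 1) * \<bar>a\<bar> powr p"
proof -
  define S where "S = \<bar>s\<bar> powr p + e powr p"
  have S: "S > 0" unfolding S_def using e by (intro add_nonneg_pos) auto
  have i: "S powr (1 - p) = 1 / S powr (p - 1)"
    using powr_minus_divide[of S "p - 1"] by simp
  have "(1 / p - 1) * p = 1 - p" using p by (simp add: field_simps)
  then have "\<bar>S powr (1 / p - 1) * phi_p p s * a\<bar> powr p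
      = S powr (1 - p) * \<bar>s\<bar> powr ((p - 1) * p) * \<bar>a\<bar> powr p"
    by (simp add: abs_mult powr_mult powr_powr abs_phi_p)
  also have "\<dots> = (\<bar>s\<bar> powr p / S) powr (p - 1) * \<bar>a\<bar> powr p"
    using S by (simp add: i powr_divide powr_powr mult.commute)
  finally show ?thesis by (simp add: S_def)
qed

lemma C1_energy_smoothed_abs_le:
  assumes T: "T > 0" and p: "p > 1" and e: "e > 0" and q: "continuous_on {0..T} q"
    and u: "C1_on T u u'"
    and ab: "{a..b} \<subseteq> {0..T}" "a \<le> b"
    and small: "\<And>x. x \<in> {a..b} \<Longrightarrow> \<bar>u x\<bar> \<le> e"
    and steep: "\<And>x. x \<in> {a..b} \<Longrightarrow> h \<le> \<bar>u' x\<bar> powr p" and h: "h \<ge> 0"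
  shows "C1_energy p T q (\<lambda>x. (\<bar>u x\<bar> powr p + e powr p) powr (1 / p))
      (\<lambda>x. (\<bar>u x\<bar> powr p + e powr p) powr (1 / p - 1) * phi_p p (u x) * u' x)
    \<le> C1_energy p T q u u' + e powr p * integral {0..T} q - h * (1 - (1 / 2) powr (p - 1)) * (b - a)"
proof -
  \<comment> \<open>\<open>r\<close> is the factor by which smoothing shrinks the gradient term, and
    \<open>g\<close> is the resulting pointwise saving. It is nonnegative everywhere and bounded
    below on \<open>{a..b}\<close>.\<close>
  define r where "r = (\<lambda>x. (\<bar>u x\<bar> powr p / (\<bar>u x\<bar> powr p + e powr p)) powr (p - 1))"
  define g where "g = (\<lambda>x. \<bar>u' x\<bar> powr p * (1 - r x))"
  note cu = C1_on_continuous[OF u]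
  have S: "\<bar>u x\<bar> powr p + e powr p > 0" for x
    using e by (intro add_nonneg_pos) auto
  have cr: "continuous_on {0..T} r"
    \<comment> \<open>The base vanishes at zeros of \<open>u\<close>; continuity there relies on the
      positive exponent \<open>p - 1\<close>.\<close>
    unfolding r_def
  proof (intro continuous_on_powr'[where f = "\<lambda>x. \<bar>u x\<bar> powr p / (\<bar>u x\<bar> powr p + e powr p)"]
      continuous_on_divide continuous_on_add continuous_on_abs_powr continuous_on_const cu p ballI)
    fix x
    show "\<bar>u x\<bar> powr p + e powr p \<noteq> 0"
      using S[of x] by linarith
    show "0 \<le> \<bar>u x\<bar> powr p / (\<bar>u x\<bar> powr p + e powr p) \<and>
        (\<bar>u x\<bar> powr p / (\<bar>u x\<bar> powr p + e powr p) = 0 \<longrightarrow> 0 < p - 1)"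
      using p by simp
  qed
  have cg: "continuous_on {0..T} g"
    unfolding g_def by (intro continuous_intros continuous_on_abs_powr cr p cu)
  have r1: "r x \<le> 1" for x
    unfolding r_def using S[of x] p by (intro powr_le1) (auto simp: divide_simps)
  have g0: "g x \<ge> 0" for x
    unfolding g_def using r1[of x] by simp
  have "C1_energy p T q (\<lambda>x. (\<bar>u x\<bar> powr p + e powr p) powr (1 / p))
      (\<lambda>x. (\<bar>u x\<bar> powr p + e powr p) powr (1 / p - 1) * phi_p p (u x) * u' x)
      = integral {0..T} (\<lambda>x. (\<bar>u' x\<bar> powr p + q x * \<bar>u x\<bar> powr p) + e powr p * q x - g x)"
    unfolding C1_energy_def abs_smoothed_abs_powr[OF p e] abs_smoothed_abs_deriv_powr[OF p e]
    by (simp add: g_def r_def algebra_simps)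
  also have "\<dots> = C1_energy p T q u u' + e powr p * integral {0..T} q - integral {0..T} g"
    unfolding C1_energy_def
    by (rule integral_unique)
      (intro has_integral_diff has_integral_add has_integral_mult_right integrable_integral
        integrable_continuous_real continuous_intros continuous_on_abs_powr p q cg cu)
  finally have eq: "C1_energy p T q (\<lambda>x. (\<bar>u x\<bar> powr p + e powr p) powr (1 / p))
      (\<lambda>x. (\<bar>u x\<bar> powr p + e powr p) powr (1 / p - 1) * phi_p p (u x) * u' x)
      = C1_energy p T q u u' + e powr p * integral {0..T} q - integral {0..T} g" .
  have "h * (1 - (1 / 2) powr (p - 1)) * (b - a) \<le> integral {0..T} g"
  proof -
    have "integral {a..b} (\<lambda>x. h * (1 - (1 / 2) powr (p - 1))) \<le> integral {a..b} g"
    proof (rule integral_le)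
      show "g integrable_on {a..b}"
        by (intro integrable_continuous_real continuous_on_subset[OF cg ab(1)])
      fix x assume x: "x \<in> {a..b}"
      have "\<bar>u x\<bar> powr p \<le> e powr p"
        using small[OF x] p by (intro powr_mono2) auto
      then have "r x \<le> (1 / 2) powr (p - 1)"
        unfolding r_def using S[of x] p by (intro powr_mono2) (auto simp: divide_simps)
      moreover have "(1 / 2 :: real) powr (p - 1) \<le> 1"
        using p by (intro powr_le1) auto
      ultimately show "h * (1 - (1 / 2) powr (p - 1)) \<le> g x"
        unfolding g_def using steep[OF x] h by (intro mult_mono) auto
    qed (rule integrable_const_ivl)
    also have "\<dots> \<le> integral {0..T} g"
      using g0 cg ab continuous_on_subset[OF cg ab(1)]
      by (intro integral_subset_le) (auto intro!: integrable_continuous_real)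
    finally show ?thesis
      using ab(2) by (simp add: mult_ac)
  qed
  then show ?thesis unfolding eq by simp
qed

lemma weighted_mass_smoothed_abs:
  assumes p: "p > 1" and e: "e > 0" and m: "continuous_on {0..T} m"
    and u: "C1_on T u u'"
  shows "weighted_mass p T m (\<lambda>x. (\<bar>u x\<bar> powr p + e powr p) powr (1 / p))
    = weighted_mass p T m u + e powr p * integral {0..T} m"
proof -
  have "weighted_mass p T m (\<lambda>x. (\<bar>u x\<bar> powr p + e powr p) powr (1 / p))
      = integral {0..T} (\<lambda>x. m x * \<bar>u x\<bar> powr p + e powr p * m x)"
    unfolding weighted_mass_def abs_smoothed_abs_powr[OF p e] by (simp add: algebra_simps)
  also have "\<dots> = weighted_mass p T m u + e powr p * integral {0..T} m"
    unfolding weighted_mass_def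
    by (rule integral_unique)
      (intro has_integral_add has_integral_mult_right integrable_integral
        integrable_continuous_real continuous_intros continuous_on_abs_powr p m C1_on_continuous[OF u])
  finally show ?thesis .
qed

subsection \<open>Picone's inequality\<close>

lemma picone_solution_pair:
  assumes T: "T > 0" and p: "p > 1" and q: "continuous_on {0..T} q" and m: "continuous_on {0..T} m"
    and s: "solution_pair p T q m l v v'" and nz: "\<And>x. x \<in> {0..T} \<Longrightarrow> v x \<noteq> 0"
    and u: "C1_on T u u'" and per: "u 0 = u T"
  shows "l * weighted_mass p T m u \<le> C1_energy p T q u u'"
proof -
  have v: "C1_on T v v'" using s by (simp add: solution_pair_def)
  note cu = C1_on_continuous[OF u] and cv = C1_on_continuous[OF v]
  \<comment> \<open>\<open>w\<close> is the slope that \<open>u\<close> would have if it were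
    proportional to \<open>v\<close>, which is the case of equality in Young's inequality.\<close>
  define w where "w = (\<lambda>x. v' x * u x * inverse (v x))"
  \<comment> \<open>\<open>F = \<phi>\<^sub>p(v') |u|\<^sup>p / \<phi>\<^sub>p(v)\<close> is periodic, so its derivative, which Young's inequality bounds by
    the integrand of \<open>E(u) - l M(u)\<close>, has integral \<open>0\<close>.\<close>
  define F where "F = (\<lambda>x. phi_p p (v' x) * (\<bar>u x\<bar> powr p * inverse (phi_p p (v x))))"
  define F' where "F' = (\<lambda>x. (q x - l * m x) * \<bar>u x\<bar> powr p
      + (p * phi_p p (w x) * u' x - (p - 1) * \<bar>w x\<bar> powr p))"
  have "(F' has_integral (F T - F 0)) {0..T}"
  proof (rule fundamental_theorem_of_calculus_interior)
    show "continuous_on {0..T} F"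
      unfolding F_def using nz
      by (intro continuous_intros continuous_on_phi_p continuous_on_abs_powr p cu cv) auto
    fix x assume x: "x \<in> {0<..<T}"
    then have vx: "v x \<noteq> 0" using nz by auto
    then have Pv: "phi_p p (v x) \<noteq> 0" by simp
    have 1: "((\<lambda>x. \<bar>u x\<bar> powr p) has_real_derivative p * phi_p p (u x) * u' x) (at x)"
      by (rule DERIV_chain2[OF has_real_derivative_abs_powr[OF p] C1_on_deriv[OF u x]])
    have 2: "((\<lambda>x. phi_p p (v x)) has_real_derivative (p - 1) * \<bar>v x\<bar> powr (p - 2) * v' x) (at x)"
      by (rule DERIV_chain2[OF has_real_derivative_phi_p[OF vx] C1_on_deriv[OF v x]])
    have 3: "((\<lambda>x. phi_p p (v' x)) has_real_derivative (q x - l * m x) * phi_p p (v x)) (at x)"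
      using s x by (simp add: solution_pair_def)
    note d = DERIV_mult[OF 3 DERIV_mult[OF 1 DERIV_inverse'[OF 2 Pv]]]
    \<comment> \<open>Once all powers are expressed through \<open>phi_p\<close> at
      \<open>u x\<close>, \<open>v x\<close> and \<open>v' x\<close>, comparing the two forms of the
      derivative of \<open>F\<close> is a rational identity.\<close>
    have a: "\<bar>v x\<bar> powr (p - 2) = phi_p p (v x) * inverse (v x)"
      using vx by (simp add: phi_p_def)
    have b: "phi_p p (w x) = phi_p p (v' x) * phi_p p (u x) * inverse (phi_p p (v x))"
      by (simp add: w_def phi_p_mult phi_p_inverse)
    have c: "\<bar>w x\<bar> powr p = phi_p p (v' x) * phi_p p (u x) * inverse (phi_p p (v x))
        * (v' x * u x * inverse (v x))"
      unfolding phi_p_times_self[symmetric] b by (simp add: w_def)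
    have e: "\<bar>u x\<bar> powr p = phi_p p (u x) * u x"
      by (simp add: phi_p_times_self)
    have "(F has_real_derivative F' x) (at x)"
      unfolding F_def F'_def
      by (rule DERIV_cong[OF d], unfold a b c e, use vx Pv in \<open>simp add: field_simps\<close>)
    then show "(F has_vector_derivative F' x) (at x)"
      by (simp add: has_real_derivative_iff_has_vector_derivative)
  qed (use T in simp)
  moreover have "F T = F 0"
    using s per by (simp add: F_def solution_pair_def)
  ultimately have "(F' has_integral 0) {0..T}"
    by simp
  moreover have "F' x \<le> (\<bar>u' x\<bar> powr p + q x * \<bar>u x\<bar> powr p) - l * (m x * \<bar>u x\<bar> powr p)" for x
    using young_phi_p[OF p, of "w x" "u' x"] by (simp add: F'_def algebra_simps)
  ultimately have "0 \<le> C1_energy p T q u u' - l * weighted_mass p T m u"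
    using has_integral_le[OF _ C1_energy_minus_weighted_mass_has_integral[OF p q m u, of l]] by blast
  then show ?thesis by simp
qed

text \<open>Each eigenfunction is tested in Picone's inequality for the other. For \<open>f\<close>
  with eigenvalue \<open>k1\<close> this reads \<open>k2 * M(f) \<le> E(f) = k1 * M(f)\<close>, and
  \<open>M(f) > 0\<close> because \<open>E(f)\<close> and \<open>k1\<close> are positive.\<close>

lemma nonvanishing_eigenvalue_unique:
  assumes T: "T > 0" and p: "p > 1"
    and q: "continuous_on {0..T} q" "\<forall>x\<in>{0..T}. q x \<ge> 0" "\<exists>x\<in>{0..T}. q x \<noteq> 0"
    and m: "continuous_on {0..T} m"
    and l: "l1 > 0" "l2 > 0"
    and s: "solution_pair p T q m l1 u u'" "solution_pair p T q m l2 v v'"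
    and nz: "\<And>x. x \<in> {0..T} \<Longrightarrow> u x \<noteq> 0" "\<And>x. x \<in> {0..T} \<Longrightarrow> v x \<noteq> 0"
  shows "l1 = l2"
proof -
  have le: "k2 \<le> k1" if k: "k1 > 0" and f: "solution_pair p T q m k1 f f'" "solution_pair p T q m k2 g g'"
    and nz: "\<And>x. x \<in> {0..T} \<Longrightarrow> f x \<noteq> 0" "\<And>x. x \<in> {0..T} \<Longrightarrow> g x \<noteq> 0" for k1 k2 f f' g g'
  proof -
    have f': "C1_on T f f'" "f 0 = f T" using f(1) by (auto simp: solution_pair_def)
    have "k2 * weighted_mass p T m f \<le> C1_energy p T q f f'"
      by (rule picone_solution_pair[OF T p q(1) m f(2) nz(2) f'])
    moreover have E: "C1_energy p T q f f' = k1 * weighted_mass p T m f"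
      by (rule solution_pair_energy[OF T p q(1) m f(1)])
    moreover have "C1_energy p T q f f' > 0"
      using nz(1)[of 0] T by (intro C1_energy_pos[OF T p q f'(1)]) auto
    ultimately show ?thesis
      using k by (simp add: zero_less_mult_iff)
  qed
  show ?thesis
    using le[OF l(1) s nz] le[OF l(2) s(2,1) nz(2,1)] by simp
qed

subsection \<open>Isolation of the principal eigenvalues\<close>

text \<open>As \<open>p > 1\<close>, the term \<open>B * e powr p\<close> is of smaller order than
  \<open>c * e\<close>: a linear gain beats a cost of order \<open>p\<close>.\<close>

lemma exists_small_powr:
  assumes p: "p > 1" and "c > 0" "A > 0" "d > 0"
  shows "\<exists>e>0::real. e \<le> d \<and> e powr p \<le> A \<and> B * e powr p \<le> c * e"
proof -
  have t: "((\<lambda>e::real. e powr r) \<longlongrightarrow> 0) (at_right 0)" if "r > 0" for r :: real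
  proof -
    have "((\<lambda>e::real. e powr r) \<longlongrightarrow> 0 powr r) (at_right 0)"
      using that by (intro tendsto_powr' tendsto_ident_at tendsto_const) (auto simp: eventually_at_filter)
    then show ?thesis by simp
  qed
  have "\<forall>\<^sub>F e::real in at_right 0. e powr p < A"
    using order_tendstoD(2)[OF t] p \<open>A > 0\<close> by simp
  moreover have "((\<lambda>e::real. B * e powr (p - 1)) \<longlongrightarrow> 0) (at_right 0)"
    using tendsto_mult_left[OF t[of "p - 1"], of B] p by simp
  then have "\<forall>\<^sub>F e::real in at_right 0. B * e powr (p - 1) < c"
    using order_tendstoD(2) \<open>c > 0\<close> by blast
  moreover have "\<forall>\<^sub>F e::real in at_right 0. 0 < e \<and> e < d"
    using \<open>d > 0\<close> by (auto simp: eventually_at_right_field)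
  ultimately have "\<forall>\<^sub>F e::real in at_right 0. e powr p < A \<and> B * e powr (p - 1) < c \<and> 0 < e \<and> e < d"
    by eventually_elim auto
  then obtain e :: real where e: "e powr p < A" "B * e powr (p - 1) < c" "0 < e" "e < d"
    using eventually_happens'[OF trivial_limit_at_right_real] by blast
  have "B * e powr p = B * e powr (p - 1) * e"
    using e(3) powr_add[of e "p - 1" 1] by simp
  also have "\<dots> \<le> c * e"
    using e by (intro mult_right_mono) auto
  finally show ?thesis
    using e by (intro exI[of _ e]) auto
qed

lemma continuous_on_Icc_abs_bound:
  fixes f :: "real \<Rightarrow> real"
  assumes "continuous_on {a..b} f"
  obtains B where "B > 0" "\<And>x. x \<in> {a..b} \<Longrightarrow> \<bar>f x\<bar> \<le> B"
proof -
  have "bounded (f ` {a..b})"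
    by (intro compact_imp_bounded compact_continuous_image assms compact_Icc)
  then show ?thesis
    using that unfolding bounded_pos by auto
qed

text \<open>The interval extends from \<open>x0\<close> towards the farther end of
  \<open>{0..T}\<close>, so it fits even if \<open>x0\<close> is an end point.\<close>

lemma subinterval_near_point:
  fixes x0 d T :: real
  assumes "x0 \<in> {0..T}" "0 \<le> d" "d \<le> T / 2"
  obtains a b where "{a..b} \<subseteq> {0..T}" "b - a = d" "\<And>x. x \<in> {a..b} \<Longrightarrow> \<bar>x - x0\<bar> \<le> d"
proof (cases "x0 \<le> T / 2")
  case True
  show ?thesis by (rule that[of x0 "x0 + d"]) (use assms True in auto)
next
  case False
  show ?thesis by (rule that[of "x0 - d" x0]) (use assms False in auto)
qed

lemma C1_on_lipschitz_at_zero: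
  assumes u: "C1_on T u u'" and L: "\<And>x. x \<in> {0..T} \<Longrightarrow> \<bar>u' x\<bar> \<le> L"
    and "x0 \<in> {0..T}" "u x0 = 0" "x \<in> {0..T}"
  shows "\<bar>u x\<bar> \<le> L * \<bar>x - x0\<bar>"
  using field_differentiable_bound[of "{0..T}" u u' L x x0] assms
  by (auto simp: C1_on_def)

text \<open>For nonpositive mass the left-hand side is at most 0 and the energy is nonnegative, so
  the Rayleigh bound extends to masses of any sign.\<close>

lemma lambda0_pos_times_weighted_mass_le:
  assumes T: "T > 0" and p: "p > 1" and q: "continuous_on {0..T} q" "\<forall>x\<in>{0..T}. q x \<ge> 0"
    and m: "continuous_on {0..T} m" and l0: "lambda0_pos p T q m \<ge> 0"
    and u: "C1_on T u u'" and per: "u 0 = u T"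
  shows "lambda0_pos p T q m * weighted_mass p T m u \<le> C1_energy p T q u u'"
proof (cases "weighted_mass p T m u > 0")
  case True
  then show ?thesis
    using lambda0_pos_le[OF T p q m u per True] by (simp add: field_simps)
next
  case False
  then have "lambda0_pos p T q m * weighted_mass p T m u \<le> 0"
    using l0 by (intro mult_nonneg_nonpos) auto
  then show ?thesis
    using C1_energy_nonneg[OF q(2), of p u u'] by linarith
qed

lemma small_eigenvalue_nonvanishing:
  assumes T: "T > 0" and p: "p > 1" and q: "continuous_on {0..T} q" "\<forall>x\<in>{0..T}. q x \<ge> 0"
    and m: "continuous_on {0..T} m" and l0: "lambda0_pos p T q m \<ge> 0"
  obtains \<delta> where "\<delta> > 0"
    "\<And>l u u' x. \<lbrakk>0 < l; l < lambda0_pos p T q m + \<delta>; solution_pair p T q m l u u';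
       \<exists>y\<in>{0..T}. u y \<noteq> 0; x \<in> {0..T}\<rbrakk> \<Longrightarrow> u x \<noteq> 0"
proof -
  let ?l0 = "lambda0_pos p T q m"
  obtain qB where qB: "qB > 0" "\<And>x. x \<in> {0..T} \<Longrightarrow> \<bar>q x\<bar> \<le> qB"
    using continuous_on_Icc_abs_bound[OF q(1)] by blast
  obtain mB where mB: "mB > 0" "\<And>x. x \<in> {0..T} \<Longrightarrow> \<bar>m x\<bar> \<le> mB"
    using continuous_on_Icc_abs_bound[OF m] by blast
  \<comment> \<open>\<open>K\<close> bounds \<open>q - l * m\<close> for every \<open>l\<close> in
    \<open>(0, ?l0 + 1)\<close>. After normalization at 0, \<open>N\<close> and
    \<open>\<eta>\<close> are the upper and lower bounds of
    \<open>\<bar>u\<bar> powr p + \<bar>u'\<bar> powr p\<close>, and \<open>L\<close> bounds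
    \<open>\<bar>u'\<bar>\<close>.\<close>
  define K where "K = qB + (?l0 + 1) * mB"
  define N where "N = exp ((p + p / (p - 1) * K) * T)"
  define \<eta> where "\<eta> = 1 / N"
  define L where "L = N powr (1 / p)"
  define k where "k = 1 - (1 / 2 :: real) powr (p - 1)"
  \<comment> \<open>The saving \<open>c * e\<close> is the steepness \<open>\<eta> / 2\<close> times
    the fraction \<open>k\<close> saved times the interval length \<open>e / L\<close>.
    \<open>B\<close> bounds the mass of \<open>u\<close>, and \<open>R * e powr p\<close> is the net
    cost of the terms of order zero.\<close>
  define c where "c = \<eta> / 2 * k / L"
  define B where "B = mB * N * T"
  define R where "R = integral {0..T} q - ?l0 * integral {0..T} m"
  have N: "N > 0" and \<eta>: "\<eta> > 0" and L: "L > 0" and B: "B > 0"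
    using T mB(1) by (simp_all add: N_def \<eta>_def L_def B_def)
  have "(1 / 2 :: real) powr (p - 1) < (1 / 2) powr 0"
    using p by (intro powr_less_mono') auto
  then have k: "k > 0" by (simp add: k_def)
  have c: "c > 0" using \<eta> L k by (simp add: c_def)
  \<comment> \<open>The conditions on \<open>e\<close> make the interval of length
    \<open>e / L\<close> fit, leave at least \<open>\<eta> / 2\<close> for the gradient on it, and
    keep the cost of order zero below half of the saving.\<close>
  obtain e where e: "e > 0" "e \<le> L * T / 2" "e powr p \<le> \<eta> / 2" "R * e powr p \<le> c / 2 * e"
    using exists_small_powr[OF p, of "c / 2" "\<eta> / 2" "L * T / 2" R] c \<eta> L T by auto
  \<comment> \<open>\<open>\<delta> \<le> 1\<close> makes \<open>K\<close> applicable; the other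
    bound lets the excess of \<open>l\<close> over \<open>?l0\<close> cost at most a quarter of the
    saving.\<close>
  define \<delta> where "\<delta> = min 1 (c * e / (4 * B))"
  have \<delta>: "\<delta> > 0" "\<delta> \<le> 1" "\<delta> * B \<le> c * e / 4"
    using c e B by (auto simp: \<delta>_def min_def field_simps)
  show ?thesis
  proof (rule that[OF \<delta>(1)])
    fix l f f' x0
    assume l: "0 < l" "l < ?l0 + \<delta>" and f: "solution_pair p T q m l f f'"
      and nz: "\<exists>y\<in>{0..T}. f y \<noteq> 0" and x0: "x0 \<in> {0..T}"
    have Kb: "\<bar>q x - l * m x\<bar> \<le> K" if x: "x \<in> {0..T}" for x
    proof -
      have "\<bar>l * m x\<bar> \<le> (?l0 + 1) * mB"
        unfolding abs_mult using l \<delta>(2) mB x by (intro mult_mono) auto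
      then show ?thesis
        using qB(2)[OF x] unfolding K_def by linarith
    qed
    define V where "V = (\<lambda>x. \<bar>f x\<bar> powr p + \<bar>f' x\<bar> powr p)"
    have Vle: "V x \<le> V y * N" if "x \<in> {0..T}" "y \<in> {0..T}" for x y
      unfolding V_def N_def using solution_pair_comparison[OF p f Kb that] .
    obtain y where y: "y \<in> {0..T}" "f y \<noteq> 0" using nz by blast
    have "V y > 0" unfolding V_def using y(2) by (intro add_pos_nonneg) auto
    then have "0 < V 0 * N" using Vle[OF y(1), of 0] T by simp
    then have V0: "V 0 > 0" using N by (simp add: zero_less_mult_iff)
    \<comment> \<open>This factor scales \<open>f\<close> to \<open>u\<close> with
      \<open>W 0 = 1\<close>.\<close>
    define a where "a = V 0 powr (- 1 / p)"
    have a: "a > 0" using V0 by (simp add: a_def)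
    have ap: "\<bar>a\<bar> powr p = 1 / V 0"
    proof -
      have "\<bar>a\<bar> powr p = V 0 powr (- 1)"
        unfolding a_def abs_of_nonneg[OF powr_ge_zero] powr_powr using p by simp
      then show ?thesis using V0 by (simp add: powr_minus_divide)
    qed
    define u where "u = (\<lambda>x. a * f x)"
    define u' where "u' = (\<lambda>x. a * f' x)"
    have s: "solution_pair p T q m l u u'"
      unfolding u_def u'_def by (rule solution_pair_scale[OF f])
    then have u: "C1_on T u u'" and per: "u 0 = u T" by (auto simp: solution_pair_def)
    define W where "W = (\<lambda>x. \<bar>u x\<bar> powr p + \<bar>u' x\<bar> powr p)"
    have WV: "W x = V x / V 0" for x
      unfolding W_def V_def u_def u'_def abs_mult by (simp add: powr_mult ap[simplified V_def] V_def add_divide_distrib)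
    have W: "\<eta> \<le> W x" "W x \<le> N" if "x \<in> {0..T}" for x
      unfolding WV using Vle[OF that, of 0] Vle[of 0 x] that T V0 N by (auto simp: \<eta>_def field_simps)
    have upN: "\<bar>u x\<bar> powr p \<le> N" if "x \<in> {0..T}" for x
      using W(2)[OF that] unfolding W_def by (smt (verit) powr_ge_zero)
    have u'L: "\<bar>u' x\<bar> \<le> L" if "x \<in> {0..T}" for x
    proof -
      have "\<bar>u' x\<bar> powr p \<le> N"
        using W(2)[OF that] unfolding W_def by (smt (verit) powr_ge_zero)
      then have "(\<bar>u' x\<bar> powr p) powr (1 / p) \<le> L"
        unfolding L_def using p by (intro powr_mono2) auto
      then show ?thesis using p by (simp add: powr_powr)
    qed
    show "f x0 \<noteq> 0"
    proof
      assume "f x0 = 0"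
      then have ux0: "u x0 = 0" by (simp add: u_def)
      have "e / L \<le> T / 2" using e(2) L by (simp add: field_simps)
      then obtain A1 A2 where A: "{A1..A2} \<subseteq> {0..T}" "A2 - A1 = e / L"
        "\<And>x. x \<in> {A1..A2} \<Longrightarrow> \<bar>x - x0\<bar> \<le> e / L"
        using subinterval_near_point[OF x0, of "e / L"] e(1) L by auto
      have small: "\<bar>u x\<bar> \<le> e" if x: "x \<in> {A1..A2}" for x
      proof -
        have "\<bar>u x\<bar> \<le> L * \<bar>x - x0\<bar>"
          using C1_on_lipschitz_at_zero[OF u u'L x0 ux0] x A(1) by blast
        also have "\<dots> \<le> L * (e / L)"
          using A(3)[OF x] L by (intro mult_left_mono) auto
        finally show ?thesis using L by simp
      qed
      have steep: "\<eta> / 2 \<le> \<bar>u' x\<bar> powr p" if x: "x \<in> {A1..A2}" for x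
      proof -
        have "\<bar>u x\<bar> powr p \<le> e powr p"
          using small[OF x] p by (intro powr_mono2) auto
        moreover have "\<eta> \<le> W x" using W(1) x A(1) by blast
        ultimately show ?thesis using e(3) unfolding W_def by linarith
      qed
      define v where "v = (\<lambda>x. (\<bar>u x\<bar> powr p + e powr p) powr (1 / p))"
      define v' where "v' = (\<lambda>x. (\<bar>u x\<bar> powr p + e powr p) powr (1 / p - 1) * phi_p p (u x) * u' x)"
      have "C1_energy p T q v v' \<le> C1_energy p T q u u' + e powr p * integral {0..T} q - \<eta> / 2 * k * (A2 - A1)"
      proof -
        have "0 < e / L" using e(1) L by simp
        then have "A1 \<le> A2" using A(2) by linarith
        then show ?thesis
          unfolding v_def v'_def k_def using \<eta>
          by (intro C1_energy_smoothed_abs_le[OF T p e(1) q(1) u A(1)] small steep) auto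
      qed
      also have "\<eta> / 2 * k * (A2 - A1) = c * e"
        by (simp add: A(2) c_def)
      finally have 1: "C1_energy p T q v v' \<le> l * weighted_mass p T m u + e powr p * integral {0..T} q - c * e"
        using solution_pair_energy[OF T p q(1) m s] by simp
      have "?l0 * weighted_mass p T m v \<le> C1_energy p T q v v'"
        using C1_on_smoothed_abs[OF p e(1) u] per
        by (intro lambda0_pos_times_weighted_mass_le[OF T p q m l0]) (auto simp: v_def v'_def)
      moreover have "weighted_mass p T m v = weighted_mass p T m u + e powr p * integral {0..T} m"
        unfolding v_def by (rule weighted_mass_smoothed_abs[OF p e(1) m u])
      ultimately have 2: "c * e \<le> (l - ?l0) * weighted_mass p T m u + R * e powr p"
        using 1 unfolding R_def by (simp add: algebra_simps)
      have "l * weighted_mass p T m u \<ge> 0"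
        using solution_pair_energy[OF T p q(1) m s] C1_energy_nonneg[OF q(2), of p u u'] by simp
      then have M0: "weighted_mass p T m u \<ge> 0"
        using l(1) by (simp add: zero_le_mult_iff)
      have "weighted_mass p T m u \<le> integral {0..T} (\<lambda>x. mB * N)"
        unfolding weighted_mass_def
      proof (rule integral_le)
        show "(\<lambda>x. m x * \<bar>u x\<bar> powr p) integrable_on {0..T}"
          using C1_on_continuous[OF u]
          by (intro integrable_continuous_real continuous_on_mult continuous_on_abs_powr p m)
        fix x assume x: "x \<in> {0..T}"
        show "m x * \<bar>u x\<bar> powr p \<le> mB * N"
          using mB upN[OF x] x N abs_le_D1[OF mB(2)[OF x]] by (intro mult_mono) auto
      qed (rule integrable_const_ivl)
      then have MB: "weighted_mass p T m u \<le> B"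
        using T by (simp add: B_def mult.commute mult.left_commute)
      have "(l - ?l0) * weighted_mass p T m u \<le> \<delta> * B"
        using l M0 MB \<delta>(1) by (intro mult_mono) auto
      \<comment> \<open>The costs add up to at most three quarters of the saving.\<close>
      then have "c * e \<le> c * e / 4 + c / 2 * e"
        using 2 \<delta>(3) e(4) by linarith
      then show False
        using c e(1) by (simp add: field_simps)
    qed
  qed
qed

text \<open>Shows both that 0 is not an eigenvalue and that the mass of an eigenfunction has the
  sign of its eigenvalue.\<close>

lemma eigenvalue_energy:
  assumes T: "T > 0" and p: "p > 1"
    and q: "continuous_on {0..T} q" "\<forall>x\<in>{0..T}. q x \<ge> 0" "\<exists>x\<in>{0..T}. q x \<noteq> 0"
    and m: "continuous_on {0..T} m"
    and s: "solution_pair p T q m l u u'" "\<exists>x\<in>{0..T}. u x \<noteq> 0"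
  shows "l * weighted_mass p T m u > 0"
proof -
  have "C1_on T u u'" using s(1) by (simp add: solution_pair_def)
  then show ?thesis
    using C1_energy_pos[OF T p q _ s(2), of u'] solution_pair_energy[OF T p q(1) m s(1)] by simp
qed

lemma lambda0_pos_isolated:
  assumes T: "T > 0" and p: "p > 1"
    and q: "continuous_on {0..T} q" "\<forall>x\<in>{0..T}. q x \<ge> 0" "\<exists>x\<in>{0..T}. q x \<noteq> 0"
    and m: "continuous_on {0..T} m"
  obtains d where "d > lambda0_pos p T q m"
    "\<And>l. \<lbrakk>0 < l; l < d; eigenvalue p T q m l\<rbrakk> \<Longrightarrow> l = lambda0_pos p T q m"
proof -
  let ?l0 = "lambda0_pos p T q m"
  have ge: "0 \<le> ?l0 \<and> ?l0 \<le> l" if l: "l > 0" "eigenvalue p T q m l" for l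
  proof -
    obtain u u' where s: "solution_pair p T q m l u u'" "\<exists>x\<in>{0..T}. u x \<noteq> 0"
      using l(2) by (auto simp: eigenvalue_iff_solution_pair)
    then have u: "C1_on T u u'" "u 0 = u T" by (auto simp: solution_pair_def)
    have M: "weighted_mass p T m u > 0"
      using eigenvalue_energy[OF T p q m s] l(1) by (simp add: zero_less_mult_iff)
    show ?thesis
      using lambda0_pos_nonneg[OF T p q(1,2) m u M] lambda0_pos_le[OF T p q(1,2) m u M]
        solution_pair_energy[OF T p q(1) m s(1)] M by simp
  qed
  show ?thesis
  \<comment> \<open>Without a positive eigenvalue the claim is vacuous. Otherwise an eigenfunction
    supplies \<open>?l0 \<ge> 0\<close>, which the choice of \<open>\<delta>\<close>
    requires.\<close>
  proof (cases "\<exists>l>0. eigenvalue p T q m l")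
    case False
    show ?thesis by (rule that[of "?l0 + 1"]) (use False in auto)
  next
    case True
    then have l0: "?l0 \<ge> 0" using ge by blast
    obtain \<delta> where \<delta>: "\<delta> > 0"
      "\<And>l u u' x. \<lbrakk>0 < l; l < ?l0 + \<delta>; solution_pair p T q m l u u';
         \<exists>y\<in>{0..T}. u y \<noteq> 0; x \<in> {0..T}\<rbrakk> \<Longrightarrow> u x \<noteq> 0"
      using small_eigenvalue_nonvanishing[OF T p q(1,2) m l0] by blast
    have unique: "l1 = l2"
      if l: "0 < l1" "l1 < ?l0 + \<delta>" "eigenvalue p T q m l1"
        "0 < l2" "l2 < ?l0 + \<delta>" "eigenvalue p T q m l2" for l1 l2
    proof -
      obtain u u' where u: "solution_pair p T q m l1 u u'" "\<exists>x\<in>{0..T}. u x \<noteq> 0"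
        using l(3) by (auto simp: eigenvalue_iff_solution_pair)
      obtain v v' where v: "solution_pair p T q m l2 v v'" "\<exists>x\<in>{0..T}. v x \<noteq> 0"
        using l(6) by (auto simp: eigenvalue_iff_solution_pair)
      show ?thesis
        by (rule nonvanishing_eigenvalue_unique[OF T p q m l(1,4) u(1) v(1)
              \<delta>(2)[OF l(1,2) u] \<delta>(2)[OF l(4,5) v]])
    qed
    show ?thesis
    \<comment> \<open>If the unique eigenvalue in \<open>(0, ?l0 + \<delta>)\<close> is some
      \<open>l\<close> above \<open>?l0\<close>, then \<open>d = l\<close> leaves none in
      \<open>(0, l)\<close>. Otherwise \<open>?l0 + \<delta>\<close> works, as no positive
      eigenvalue lies below \<open>?l0\<close>.\<close>
    proof (cases "\<exists>l. ?l0 < l \<and> l < ?l0 + \<delta> \<and> eigenvalue p T q m l")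
      case True
      then obtain l where l: "?l0 < l" "l < ?l0 + \<delta>" "eigenvalue p T q m l" by blast
      show ?thesis
      proof (rule that[OF l(1)])
        fix k assume k: "0 < k" "k < l" "eigenvalue p T q m k"
        then have "k = l"
          using l l0 by (intro unique) auto
        then show "k = ?l0" using k(2) by simp
      qed
    next
      case False
      show ?thesis
      proof (rule that[of "?l0 + \<delta>"])
        fix k assume "0 < k" "k < ?l0 + \<delta>" "eigenvalue p T q m k"
        then show "k = ?l0" using False ge[of k] by force
      qed (use \<delta>(1) in simp)
    qed
  qed
qed

section \<open>Changing the sign of the weight\<close>

lemma eigenvalue_uminus: "eigenvalue p T q (\<lambda>x. - m x) (- l) \<longleftrightarrow> eigenvalue p T q m l"
  by (simp add: eigenvalue_def periodic_solution_def)

text \<open>The infimum of a set of reals is by definition the negative of the supremum of the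
  negated set.\<close>

lemma lambda0_neg_eq: "lambda0_neg p T q m = - lambda0_pos p T q (\<lambda>x. - m x)"
proof -
  let ?A = "{energy p T q u g |u g. W1p_per p T u g \<and> (LINT x:{0<..<T}|lborel. - m x * \<bar>u x\<bar> powr p) = 1}"
  have "{- energy p T q u g |u g. W1p_per p T u g \<and> (LINT x:{0<..<T}|lborel. - m x * \<bar>u x\<bar> powr p) = 1}
      = uminus ` ?A"
    by auto
  then show ?thesis
    by (simp add: lambda0_neg_def lambda0_pos_def Inf_real_def)
qed

theorem proposition3p1:
  fixes p T :: real and q m :: "real \<Rightarrow> real"
  assumes "T > 0" and "p > 1"
    and "continuous_on {0..T} q" and "\<forall>x\<in>{0..T}. q x \<ge> 0" and "\<exists>x\<in>{0..T}. q x \<noteq> 0"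
    and "continuous_on {0..T} m" and "\<exists>x\<in>{0..T}. m x > 0" and "\<exists>x\<in>{0..T}. m x < 0"
  shows "\<exists>dp dn. dp > lambda0_pos p T q m \<and> dn < lambda0_neg p T q m \<and>
           (\<forall>l\<in>{dn<..<dp}. eigenvalue p T q m l \<longrightarrow>
              l = lambda0_pos p T q m \<or> l = lambda0_neg p T q m)"
proof -
  obtain dp where dp: "dp > lambda0_pos p T q m"
    "\<And>l. \<lbrakk>0 < l; l < dp; eigenvalue p T q m l\<rbrakk> \<Longrightarrow> l = lambda0_pos p T q m"
    using lambda0_pos_isolated[OF assms(1-6)] by blast
  obtain d where d: "d > lambda0_pos p T q (\<lambda>x. - m x)"
    "\<And>l. \<lbrakk>0 < l; l < d; eigenvalue p T q (\<lambda>x. - m x) l\<rbrakk> \<Longrightarrow> l = lambda0_pos p T q (\<lambda>x. - m x)"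
    using lambda0_pos_isolated[OF assms(1-5) continuous_on_minus[OF assms(6)]] by blast
  have "l = lambda0_pos p T q m \<or> l = lambda0_neg p T q m"
    if l: "- d < l" "l < dp" "eigenvalue p T q m l" for l
  proof -
    obtain u u' where "solution_pair p T q m l u u'" "\<exists>x\<in>{0..T}. u x \<noteq> 0"
      using l(3) by (auto simp: eigenvalue_iff_solution_pair)
    \<comment> \<open>The two isolation results concern positive eigenvalues of \<open>m\<close> and
      of \<open>- m\<close>; this closes the gap at 0 between them.\<close>
    from eigenvalue_energy[OF assms(1-6) this] have "l \<noteq> 0" by auto
    then consider "l > 0" | "l < 0" by linarith
    then show ?thesis
    proof cases
      case 1
      then show ?thesis using dp(2) l by blast
    next
      case 2
      then have "- l = lambda0_pos p T q (\<lambda>x. - m x)"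
        using l by (intro d(2)) (auto simp: eigenvalue_uminus)
      then show ?thesis by (simp add: lambda0_neg_eq)
    qed
  qed
  then show ?thesis
    using dp(1) d(1) by (intro exI[of _ dp] exI[of _ "- d"]) (auto simp: lambda0_neg_eq)
qed

end
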